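(* Let $M \ge 2$ and $p \ge 1$ be integers, let $I=\{0,1,\dots,M^{p+1}-1\}$, and for $N \in \{1,\dots,M-1\}$ and $j \in \{0,\dots,M-1\}$ let $T_j(N) := \{ m \in I : \mathcal{B}_{M,N}(m) \equiv j \pmod M\}$. Then the sets $T_0(N),\dots,T_{M-1}(N)$ form a solution of the Prouhet–Tarry–Escott problem of degree $p$, i.e. $\sum_{m\in T_j(N)} m^k$ is independent of $j$ for every $k=0,1,\dots,p$, if and only if $\gcd(M,N)=1$. Furthermore, distinct values $N\in\{1,\dots,M-1\}$ with $\gcd(M,N)=1$ produce distinct partitions $(T_0(N),\dots,T_{M-1}(N))$, so this construction yields exactly $\varphi(M)$ distinct such solutions, where $\varphi$ is Euler's totient function.
   Context: For integers $M\ge 2$, $N \ge 1$ and $n\ge 0$ with base-$M$ expansion $n=\sum_{i\ge 0} d_i(n) M^i$, $d_i(n)\in\{0,\dots,M-1\}$, the base-shifting map is $\mathcal{B}_{M,N}(n) := \sum_{i\ge 0} d_i(n) N^i$. *)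

theory Defs
  imports Main "HOL-Number_Theory.Cong" "HOL-Number_Theory.Totient"
begin

definition digit :: "nat \<Rightarrow> nat \<Rightarrow> nat \<Rightarrow> nat" where
  "digit M n i = n div M ^ i mod M"

text \<open>The digit sum over all positions has finite support only for \<open>M \<ge> 2\<close>; it is written as
  the sum over that support, so it carries its meaning for such \<open>M\<close> only.\<close>

definition base_shift :: "nat \<Rightarrow> nat \<Rightarrow> nat \<Rightarrow> nat" where
  "base_shift M N n = (\<Sum>i | digit M n i \<noteq> 0. digit M n i * N ^ i)"

lemma digit_support:
  assumes "M \<ge> 2"
  shows "{i. digit M n i \<noteq> 0} \<subseteq> {..<n}"
proof
  fix i assume "i \<in> {i. digit M n i \<noteq> 0}"
  then have "n div M ^ i \<noteq> 0" by (intro notI) (simp add: digit_def)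
  then have "M ^ i \<le> n" using div_less not_less by blast
  moreover have "i < M ^ i" using assms by (intro power_gt_expt) auto
  ultimately show "i \<in> {..<n}" by simp
qed

lemma sum_digit_lessThan:
  "(\<Sum>i<k. digit M n i * M ^ i) = n mod M ^ k"
proof (induction k)
  case (Suc k)
  then show ?case
    using mod_mult2_eq[of n "M ^ k" M] by (simp add: digit_def mult.commute)
qed simp

lemma base_shift_same_base:
  assumes "M \<ge> 2"
  shows "base_shift M M n = n"
proof -
  have "base_shift M M n = (\<Sum>i<n. digit M n i * M ^ i)"
    unfolding base_shift_def using digit_support[OF assms]
    by (intro sum.mono_neutral_left) auto
  moreover have "n < M ^ n" using assms by (intro power_gt_expt) auto
  ultimately show ?thesis by (simp add: sum_digit_lessThan)
qed

definition shift_class :: "nat \<Rightarrow> nat \<Rightarrow> nat \<Rightarrow> nat \<Rightarrow> nat set" where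
  "shift_class M p N j = {m \<in> {0..M ^ (p + 1) - 1}. [base_shift M N m = j] (mod M)}"

text \<open>The ordered tuple of the classes for \<open>j = 0, \<dots>, M - 1\<close>; its \<^const>\<open>set\<close> is the underlying
  unordered partition.\<close>

definition shift_classes :: "nat \<Rightarrow> nat \<Rightarrow> nat \<Rightarrow> nat set list" where
  "shift_classes M p N = map (shift_class M p N) [0..<M]"

text \<open>For \<open>k = 0\<close> the condition says that the sets have equal cardinality, as \<open>0 ^ 0 = 1\<close>.\<close>

definition PTE_solution :: "nat \<Rightarrow> nat set list \<Rightarrow> bool" where
  "PTE_solution p Ss \<longleftrightarrow>
     (\<forall>k\<le>p. \<forall>i<length Ss. \<forall>j<length Ss. (\<Sum>m\<in>Ss ! i. m ^ k) = (\<Sum>m\<in>Ss ! j. m ^ k))"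

end

theory Submission imports Defs begin

text \<open>Write \<open>\<B>(d + M m) = d + N \<B>(m)\<close> for a last digit \<open>d\<close>. For \<open>N\<close> coprime to \<open>M\<close>,
  induct on the number of digits: expand \<open>(d + M m)\<^sup>k\<close> binomially; the terms with \<open>m\<^sup>i\<close>, \<open>i < k\<close>,
  are class-independent by induction, while in the leading term the sum over \<open>d\<close> turns the sum
  over a class into a sum over all \<open>m\<close>. If \<open>g = gcd M N > 1\<close>, then \<open>\<B>(m) \<equiv> m (mod g)\<close>, so the
  classes glue to the residue classes modulo \<open>g\<close>, whose sums (\<open>k = 1\<close>) differ. Finally, \<open>N\<close> can be
  recovered from the partition because \<open>M\<close> lies in the same block as \<open>N\<close>.\<close>

section \<open>Digit recursion for the base shift\<close>

lemma base_shift_eq_sum: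
  assumes "M \<ge> 2" "n \<le> k"
  shows "base_shift M N n = (\<Sum>i<k. digit M n i * N ^ i)"
  unfolding base_shift_def using digit_support[OF assms(1), of n] assms(2)
  by (intro sum.mono_neutral_left) auto

text \<open>Division by \<open>M\<close> drops the last digit and moves every other digit down one
  position. The range \<open>{..<n}\<close> also serves for the digits of \<open>n div M\<close>, as
  \<open>n div M \<le> n\<close>.\<close>

lemma base_shift_rec:
  assumes "M \<ge> 2"
  shows "base_shift M N n = n mod M + N * base_shift M N (n div M)"
proof -
  have dig: "digit M n (Suc i) = digit M (n div M) i" for i
    by (simp add: digit_def div_mult2_eq)
  have "base_shift M N n = (\<Sum>i<Suc n. digit M n i * N ^ i)"
    using assms by (intro base_shift_eq_sum) auto
  also have "\<dots> = n mod M + (\<Sum>i<n. digit M (n div M) i * N ^ Suc i)"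
    unfolding sum.lessThan_Suc_shift dig by (simp add: digit_def)
  also have "(\<Sum>i<n. digit M (n div M) i * N ^ Suc i) = N * (\<Sum>i<n. digit M (n div M) i * N ^ i)"
    by (simp add: sum_distrib_left algebra_simps)
  also have "(\<Sum>i<n. digit M (n div M) i * N ^ i) = base_shift M N (n div M)"
    using assms by (intro base_shift_eq_sum[symmetric]) auto
  finally show ?thesis .
qed

lemma base_shift_less:
  assumes "M \<ge> 2" "n < M"
  shows "base_shift M N n = n"
  using assms base_shift_rec[of M N n] by (simp add: base_shift_def digit_def)

lemma base_shift_base:
  assumes "M \<ge> 2"
  shows "base_shift M N M = N"
  using assms base_shift_rec[of M N M] by (simp add: base_shift_less)

section \<open>Linear congruences modulo \<open>M\<close>\<close>

lemma cong_add_ex1_nat: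
  fixes M b j :: nat
  assumes "M > 0"
  shows "\<exists>!d. d < M \<and> [d + b = j] (mod M)"
proof (rule ex_ex1I)
  \<comment> \<open>Modulo \<open>M\<close>, the term \<open>(M - 1) * b\<close> stands for
    \<open>- b\<close>, which avoids truncated subtraction.\<close>
  have "(j + (M - 1) * b) + b = j + M * b"
    using assms by (cases M) auto
  then have "((j + (M - 1) * b) mod M + b) mod M = (j + M * b) mod M"
    by (metis mod_add_left_eq)
  then have "[(j + (M - 1) * b) mod M + b = j] (mod M)"
    by (simp add: cong_def)
  then show "\<exists>d. d < M \<and> [d + b = j] (mod M)"
    using assms by (intro exI[of _ "(j + (M - 1) * b) mod M"]) simp
next
  fix d e assume "d < M \<and> [d + b = j] (mod M)" "e < M \<and> [e + b = j] (mod M)"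
  then have "d < M" "e < M" "[d + b = e + b] (mod M)"
    by (auto simp: cong_def)
  then show "d = e"
    by (simp add: cong_add_rcancel_nat cong_less_modulus_unique_nat)
qed

text \<open>\<open>N\<close> has an inverse \<open>x\<close> modulo \<open>M\<close>, so the
  solutions \<open>b\<close> form the single residue class of \<open>x * e\<close>, where
  \<open>e\<close> represents \<open>j - d\<close>. In the induction on digits, fixing the last
  digit \<open>d\<close> thus leaves a class condition on the remaining digits.\<close>

lemma cong_linear_iff_nat:
  fixes M N d j :: nat
  assumes "M > 0" "coprime N M"
  obtains c where "\<And>b. [d + N * b = j] (mod M) \<longleftrightarrow> [b = c] (mod M)"
proof -
  obtain x where x: "[N * x = 1] (mod M)"
    using cong_solve_coprime_nat[OF assms(2)] by auto
  obtain e where e: "[e + d = j] (mod M)"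
    using cong_add_ex1_nat[OF assms(1)] by blast
  have "[N * x * e = 1 * e] (mod M)"
    using x by (rule cong_scalar_right)
  then have xe: "[N * (x * e) = e] (mod M)"
    by (simp add: mult.assoc)
  have "[d + N * b = j] (mod M) \<longleftrightarrow> [b = x * e] (mod M)" for b
  proof -
    have "[d + N * b = j] (mod M) \<longleftrightarrow> [d + N * b = d + e] (mod M)"
      using e by (simp add: cong_def add.commute)
    also have "\<dots> \<longleftrightarrow> [N * b = N * (x * e)] (mod M)"
      using xe by (simp add: cong_add_lcancel_nat) (simp add: cong_def)
    also have "\<dots> \<longleftrightarrow> [b = x * e] (mod M)"
      by (rule cong_mult_lcancel_nat[OF assms(2)])
    finally show ?thesis .
  qed
  then show ?thesis by (rule that)
qed

section \<open>Power sums over the classes for coprime \<open>N\<close>\<close>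

text \<open>The number \<open>n\<close> of digits is kept apart from the exponent \<open>k\<close>
  to allow induction on \<open>n\<close>; the sums over \<open>shift_class M p N j\<close> are the
  case \<open>n = p + 1\<close>.\<close>

definition class_power_sum :: "nat \<Rightarrow> nat \<Rightarrow> nat \<Rightarrow> nat \<Rightarrow> nat \<Rightarrow> nat" where
  "class_power_sum M N n j k = (\<Sum>m | m < M ^ n \<and> [base_shift M N m = j] (mod M). m ^ k)"

text \<open>The bijection \<open>(d, m) \<mapsto> d + M * m\<close> splits off the last digit
  \<open>d\<close>, and \<open>base_shift_rec\<close> translates the congruence.\<close>

lemma class_power_sum_Suc:
  assumes "M \<ge> 2"
  shows "class_power_sum M N (Suc n) j k =
    (\<Sum>d<M. \<Sum>m | m < M ^ n \<and> [d + N * base_shift M N m = j] (mod M). (d + M * m) ^ k)"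
proof -
  let ?A = "\<lambda>d. {m. m < M ^ n \<and> [d + N * base_shift M N m = j] (mod M)}"
  have lt: "d + M * m < M * M ^ n" if "d < M" "m < M ^ n" for d m
  proof -
    have "d + M * m < M * Suc m" using that by simp
    also have "\<dots> \<le> M * M ^ n" using that by (intro mult_le_mono) auto
    finally show ?thesis .
  qed
  have "(\<Sum>d<M. \<Sum>m\<in>?A d. (d + M * m) ^ k) = (\<Sum>(d, m)\<in>Sigma {..<M} ?A. (d + M * m) ^ k)"
    by (rule sum.Sigma) auto
  also have "\<dots> = class_power_sum M N (Suc n) j k"
    unfolding class_power_sum_def
  proof (rule sum.reindex_bij_witness[of _ "\<lambda>m. (m mod M, m div M)" "\<lambda>(d, m). d + M * m"])
    fix m assume m: "m \<in> {m. m < M ^ Suc n \<and> [base_shift M N m = j] (mod M)}"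
    then show "(m mod M, m div M) \<in> Sigma {..<M} ?A"
      using assms base_shift_rec[of M N m]
      by (auto simp: less_mult_imp_div_less mult.commute)
  next
    fix x assume "x \<in> Sigma {..<M} ?A"
    then show "(case x of (d, m) \<Rightarrow> d + M * m) \<in>
        {m. m < M ^ Suc n \<and> [base_shift M N m = j] (mod M)}"
      using assms lt base_shift_rec[of M N "fst x + M * snd x"] by auto
  qed auto
  finally show ?thesis ..
qed

text \<open>Each further digit gains one degree. Powers \<open>i < k\<close> fall under the
  induction hypothesis because \<open>k \<le> n\<close> in the step to \<open>Suc n\<close>; the
  leading power \<open>k\<close> may equal \<open>n\<close> and needs the separate argument by
  summation over \<open>d\<close>.\<close>

lemma class_power_sum_indep:
  assumes M: "M \<ge> 2" and "coprime N M" and "k < n"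
  shows "class_power_sum M N n j k = class_power_sum M N n j' k"
  using \<open>k < n\<close>
proof (induction n arbitrary: j j' k)
  case (Suc n)
  define A where "A j d = {m. m < M ^ n \<and> [d + N * base_shift M N m = j] (mod M)}" for j d
  have expand: "class_power_sum M N (Suc n) j k =
      (\<Sum>i\<le>k. (k choose i) * M ^ i * (\<Sum>d<M. d ^ (k - i) * (\<Sum>m\<in>A j d. m ^ i)))" for j
  proof -
    have "(d + M * m) ^ k = (\<Sum>i\<le>k. (k choose i) * M ^ i * (d ^ (k - i) * m ^ i))" for d m
      unfolding add.commute[of d] binomial_ring
      by (simp add: power_mult_distrib algebra_simps)
    then have "class_power_sum M N (Suc n) j k =
        (\<Sum>d<M. \<Sum>m\<in>A j d. \<Sum>i\<le>k. (k choose i) * M ^ i * (d ^ (k - i) * m ^ i))"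
      by (simp add: class_power_sum_Suc[OF M] A_def)
    also have "\<dots> = (\<Sum>d<M. \<Sum>i\<le>k. \<Sum>m\<in>A j d. (k choose i) * M ^ i * (d ^ (k - i) * m ^ i))"
      by (intro sum.cong refl sum.swap)
    also have "\<dots> = (\<Sum>i\<le>k. \<Sum>d<M. \<Sum>m\<in>A j d. (k choose i) * M ^ i * (d ^ (k - i) * m ^ i))"
      by (rule sum.swap)
    finally show ?thesis
      by (simp add: sum_distrib_left)
  qed
  have inner: "(\<Sum>d<M. d ^ (k - i) * (\<Sum>m\<in>A j d. m ^ i)) =
      (\<Sum>d<M. d ^ (k - i) * (\<Sum>m\<in>A j' d. m ^ i))" if "i \<le> k" for i
  proof (cases "i = k")
    case True
    \<comment> \<open>The weight \<open>d ^ (k - i)\<close> is now 1, and every \<open>m\<close>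
      belongs to \<open>A j d\<close> for exactly one last digit \<open>d\<close>, whatever
      \<open>j\<close> is.\<close>
    have "(\<Sum>d<M. \<Sum>m\<in>A j d. m ^ k) = (\<Sum>m<M ^ n. m ^ k)" for j
    proof -
      have "(\<Sum>d<M. \<Sum>m\<in>A j d. m ^ k) =
          (\<Sum>m<M ^ n. \<Sum>d | d \<in> {..<M} \<and> [d + N * base_shift M N m = j] (mod M). m ^ k)"
        using sum.swap_restrict[of "{..<M}" "{..<M ^ n}" "\<lambda>_ m. m ^ k"
            "\<lambda>d m. [d + N * base_shift M N m = j] (mod M)"]
        by (simp add: A_def)
      also have "\<dots> = (\<Sum>m<M ^ n. m ^ k)"
      proof (intro sum.cong refl)
        fix m
        obtain d where "{d. d \<in> {..<M} \<and> [d + N * base_shift M N m = j] (mod M)} = {d}"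
          using cong_add_ex1_nat[of M "N * base_shift M N m" j] M by fastforce
        then show "(\<Sum>d | d \<in> {..<M} \<and> [d + N * base_shift M N m = j] (mod M). m ^ k) = m ^ k"
          by simp
      qed
      finally show ?thesis .
    qed
    with True show ?thesis by simp
  next
    case False
    with that Suc.prems have "i < n" by simp
    \<comment> \<open>The index \<open>c\<close> varies with \<open>j\<close> and \<open>d\<close>,
      but the induction hypothesis equates the sums for any two indices.\<close>
    have "\<exists>c. (\<Sum>m\<in>A j d. m ^ i) = class_power_sum M N n c i" for j d
    proof -
      have "M > 0" using M by simp
      then obtain c where "\<And>b. [d + N * b = j] (mod M) \<longleftrightarrow> [b = c] (mod M)"
        using cong_linear_iff_nat[of M N d j] \<open>coprime N M\<close> by blast
      then show ?thesis by (auto simp: A_def class_power_sum_def)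
    qed
    then have "(\<Sum>m\<in>A j d. m ^ i) = (\<Sum>m\<in>A j' d. m ^ i)" for d
      using Suc.IH[OF \<open>i < n\<close>] by metis
    then show ?thesis by simp
  qed
  show ?case
    unfolding expand by (intro sum.cong refl) (simp add: inner)
qed simp

lemma shift_class_altdef:
  assumes "M \<ge> 2"
  shows "shift_class M p N j = {m. m < M ^ (p + 1) \<and> [base_shift M N m = j] (mod M)}"
proof -
  have "M ^ (p + 1) > 0" using assms by simp
  then have "m \<in> {0..M ^ (p + 1) - 1} \<longleftrightarrow> m < M ^ (p + 1)" for m
    by (simp only: atLeastAtMost_iff) linarith
  then show ?thesis unfolding shift_class_def by simp
qed

lemma PTE_solution_shift_classes_iff:
  "PTE_solution p (shift_classes M p N) \<longleftrightarrow>
    (\<forall>k\<le>p. \<forall>i<M. \<forall>j<M. (\<Sum>m\<in>shift_class M p N i. m ^ k) = (\<Sum>m\<in>shift_class M p N j. m ^ k))"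
  by (simp add: PTE_solution_def shift_classes_def)

lemma PTE_solution_if_coprime:
  assumes "M \<ge> 2" "coprime N M"
  shows "PTE_solution p (shift_classes M p N)"
  using class_power_sum_indep[OF assms, of _ "p + 1"]
  by (simp add: PTE_solution_shift_classes_iff shift_class_altdef assms class_power_sum_def)

section \<open>Residue classes modulo a common divisor of \<open>M\<close> and
  \<open>N\<close>\<close>

lemma bij_betw_residue_class:
  fixes g r :: nat
  assumes "r < g"
  shows "bij_betw (\<lambda>q. g * q + r) {..<Q} {m. m < g * Q \<and> m mod g = r}"
proof (rule bij_betw_byWitness[where f' = "\<lambda>m. m div g"])
  have "g * q + r < g * Q" if "q < Q" for q
  proof -
    have "g * q + r < g * Suc q" using assms by simp
    also have "\<dots> \<le> g * Q" using that by (intro mult_le_mono) auto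
    finally show ?thesis .
  qed
  then show "(\<lambda>q. g * q + r) ` {..<Q} \<subseteq> {m. m < g * Q \<and> m mod g = r}"
    using assms by auto
qed (use assms in \<open>auto simp: less_mult_imp_div_less mult.commute\<close>)

text \<open>The term \<open>Q * r\<close> is what tells the residue classes apart.\<close>

lemma sum_residue_class:
  fixes g r :: nat
  assumes "r < g"
  shows "(\<Sum>m | m < g * Q \<and> m mod g = r. m) = (\<Sum>q<Q. g * q) + Q * r"
  using sum.reindex_bij_betw[OF bij_betw_residue_class[OF assms], of "\<lambda>m. m" Q, symmetric]
  by (simp add: sum.distrib)

text \<open>As \<open>g\<close> divides both \<open>M\<close> and \<open>N\<close>, one step of the
  recursion already gives \<open>base_shift M N m mod g = m mod g\<close>. Hence the disjoint
  classes with index congruent to \<open>r\<close> fill exactly the residue class of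
  \<open>r\<close>.\<close>

lemma sum_shift_classes_residue:
  assumes M: "M \<ge> 2" and g: "g dvd M" "g dvd N"
  shows "(\<Sum>j | j < M \<and> j mod g = r. \<Sum>m\<in>shift_class M p N j. m) =
    (\<Sum>m | m < M ^ (p + 1) \<and> m mod g = r. m)"
proof -
  have "base_shift M N m mod g = m mod g" for m
    using g by (subst base_shift_rec[OF M])
      (simp add: mod_mod_cancel mod_add_eq[symmetric] dvd_mult2 del: mod_add_eq)
  then have mod_g: "j mod g = m mod g" if "[base_shift M N m = j] (mod M)" for j m
    using that g(1) by (metis cong_def mod_mod_cancel)
  have "(\<Sum>j\<in>{j. j < M \<and> j mod g = r}. \<Sum>m\<in>shift_class M p N j. m) =
      sum (\<lambda>m. m) (\<Union>j\<in>{j. j < M \<and> j mod g = r}. shift_class M p N j)"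
    by (rule sum.UNION_disjoint[symmetric])
      (auto simp: shift_class_altdef[OF M] cong_def)
  also have "(\<Union>j\<in>{j. j < M \<and> j mod g = r}. shift_class M p N j) =
      {m. m < M ^ (p + 1) \<and> m mod g = r}"
  proof (intro equalityI subsetI)
    fix m assume m: "m \<in> {m. m < M ^ (p + 1) \<and> m mod g = r}"
    have "[base_shift M N m = base_shift M N m mod M] (mod M)"
      by (simp add: cong_def)
    moreover have "base_shift M N m mod M < M" using M by simp
    ultimately show "m \<in> (\<Union>j\<in>{j. j < M \<and> j mod g = r}. shift_class M p N j)"
      using m mod_g by (force simp: shift_class_altdef[OF M])
  qed (use mod_g in \<open>auto simp: shift_class_altdef[OF M]\<close>)
  finally show ?thesis .
qed

text \<open>If all classes had the same sum \<open>s\<close>, each residue class modulo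
  \<open>g\<close> would have sum \<open>L * s\<close>, being glued from \<open>L\<close> classes.
  But for \<open>g > 1\<close> the sums for the residues 0 and 1 differ by
  \<open>Q > 0\<close>.\<close>

lemma coprime_if_PTE_solution:
  assumes M: "M \<ge> 2" and p: "p \<ge> 1" and PTE: "PTE_solution p (shift_classes M p N)"
  shows "gcd M N = 1"
proof (rule ccontr)
  define g where "g = gcd M N"
  assume "gcd M N \<noteq> 1"
  then have g: "g > 1" "g dvd M" "g dvd N"
    using M gcd_pos_nat[of M N] unfolding g_def by (linarith, simp_all)
  obtain L where L: "M = g * L" using g(2) by blast
  define s where "s = (\<Sum>m\<in>shift_class M p N 0. m)"
  have s: "(\<Sum>m\<in>shift_class M p N j. m) = s" if "j < M" for j
    using PTE[unfolded PTE_solution_shift_classes_iff, rule_format, of 1 j 0] p that M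
    by (simp add: s_def)
  define Q where "Q = L * M ^ p"
  have Q: "M ^ (p + 1) = g * Q" "Q > 0"
    using M L by (auto simp: Q_def intro!: Nat.gr0I)
  have card_eq: "card {j. j < M \<and> j mod g = r} = L" if "r < g" for r
    \<comment> \<open>Here the bijection counts indices rather than elements:
      \<open>M = g * L\<close> takes the place of \<open>g * Q\<close>.\<close>
    using bij_betw_same_card[OF bij_betw_residue_class[OF that, of L]] L by simp
  have "(\<Sum>q<Q. g * q) + Q * r = L * s" if "r < g" for r
    using sum_shift_classes_residue[OF M g(2,3), of p r] s card_eq[OF that]
      sum_residue_class[OF that, of Q] Q by simp
  from this[of 0] this[of 1] show False
    using g Q by simp
qed

section \<open>Recovering \<open>N\<close> from the partition\<close>

text \<open>One-digit numbers are fixed by the base shift. A block of the unordered partition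
  therefore still reveals its index, as its only element below \<open>M\<close>.\<close>

lemma mem_shift_class_less:
  assumes "M \<ge> 2" "d < M" "j < M"
  shows "d \<in> shift_class M p N j \<longleftrightarrow> d = j"
proof -
  have "M ^ 1 \<le> M ^ (p + 1)" using assms by (intro power_increasing) auto
  then have "d < M ^ (p + 1)"
    using assms(2) by (simp only: power_one_right)
  then show ?thesis
    using assms by (auto simp: shift_class_altdef base_shift_less cong_def)
qed

text \<open>The shift of \<open>M\<close>, whose digits are 0 and 1, is \<open>N\<close>; the bound
  \<open>p \<ge> 1\<close> puts \<open>M\<close> into the range covered by the classes.\<close>

lemma mem_shift_class_base:
  assumes "M \<ge> 2" "p \<ge> 1" "N < M" "j < M"
  shows "M \<in> shift_class M p N j \<longleftrightarrow> N = j"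
proof -
  have "M ^ 1 < M ^ (p + 1)" using assms by (intro power_strict_increasing) auto
  then show ?thesis
    using assms by (auto simp: shift_class_altdef base_shift_base cong_def)
qed

lemma inj_on_set_shift_classes:
  assumes M: "M \<ge> 2" and p: "p \<ge> 1"
  shows "inj_on (\<lambda>N. set (shift_classes M p N)) {..<M}"
proof (rule inj_onI)
  fix N N' assume N: "N \<in> {..<M}" "N' \<in> {..<M}"
    and eq: "set (shift_classes M p N) = set (shift_classes M p N')"
  have "shift_class M p N N \<in> set (shift_classes M p N)"
    using N by (simp add: shift_classes_def)
  then obtain j where j: "j < M" "shift_class M p N N = shift_class M p N' j"
    unfolding eq by (auto simp: shift_classes_def)
  have "N \<in> shift_class M p N N" "M \<in> shift_class M p N N"
    using N M p by (simp_all add: mem_shift_class_less mem_shift_class_base)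
  \<comment> \<open>Seen as block \<open>j\<close> of the second partition, the common block has
    \<open>N\<close> as an element below \<open>M\<close>, forcing \<open>N = j\<close>, and
    contains \<open>M\<close>, forcing \<open>N' = j\<close>.\<close>
  then have "N = j" "N' = j"
    using N M p j by (simp_all add: mem_shift_class_less mem_shift_class_base)
  then show "N = N'" by simp
qed

theorem theorem3p2:
  fixes M p :: nat
  assumes "M \<ge> 2" and "p \<ge> 1"
  shows "(\<forall>N\<in>{1..M - 1}. PTE_solution p (shift_classes M p N) \<longleftrightarrow> gcd M N = 1) \<and>
    (\<forall>N\<in>{1..M - 1}. \<forall>N'\<in>{1..M - 1}. gcd M N = 1 \<longrightarrow> gcd M N' = 1 \<longrightarrow> N \<noteq> N' \<longrightarrow>
       shift_classes M p N \<noteq> shift_classes M p N' \<and>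
       set (shift_classes M p N) \<noteq> set (shift_classes M p N')) \<and>
    card {shift_classes M p N | N. N \<in> {1..M - 1} \<and> PTE_solution p (shift_classes M p N)}
      = totient M \<and>
    card {set (shift_classes M p N) | N. N \<in> {1..M - 1} \<and> PTE_solution p (shift_classes M p N)}
      = totient M"
proof (intro conjI)
  have PTE_iff: "PTE_solution p (shift_classes M p N) \<longleftrightarrow> gcd M N = 1" for N
    using PTE_solution_if_coprime[of M N p] coprime_if_PTE_solution[of M p N] assms
    unfolding gcd.commute[of M] coprime_iff_gcd_eq_1[symmetric] by blast
  then show "\<forall>N\<in>{1..M - 1}. PTE_solution p (shift_classes M p N) \<longleftrightarrow> gcd M N = 1"
    by simp
  have inj_set: "inj_on (\<lambda>N. set (shift_classes M p N)) {..<M}"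
    using assms by (rule inj_on_set_shift_classes)
  then have inj: "inj_on (shift_classes M p) {..<M}"
    by (auto simp: inj_on_def)
  have sub: "N \<in> {..<M}" if "N \<in> {1..M - 1}" for N
    using that assms by auto
  show "\<forall>N\<in>{1..M - 1}. \<forall>N'\<in>{1..M - 1}. gcd M N = 1 \<longrightarrow> gcd M N' = 1 \<longrightarrow> N \<noteq> N' \<longrightarrow>
       shift_classes M p N \<noteq> shift_classes M p N' \<and>
       set (shift_classes M p N) \<noteq> set (shift_classes M p N')"
    using inj_on_eq_iff[OF inj_set sub sub] inj_on_eq_iff[OF inj sub sub] by simp
  define C where "C = {N \<in> {1..M - 1}. PTE_solution p (shift_classes M p N)}"
  have "C = totatives M"
  proof -
    \<comment> \<open>\<open>totatives M\<close> admits values up to \<open>M\<close>, while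
      \<open>C\<close> stops at \<open>M - 1\<close>; since \<open>M \<ge> 2\<close>,
      \<open>M\<close> is not coprime to itself.\<close>
    have "N \<noteq> M" if "coprime N M" for N using that assms by auto
    then show ?thesis
      unfolding C_def PTE_iff totatives_def gcd.commute[of M] coprime_iff_gcd_eq_1[symmetric]
      by force
  qed
  then have card_C: "card C = totient M"
    by (simp add: totient_def)
  have "C \<subseteq> {..<M}" unfolding C_def using sub by blast
  then have "card (shift_classes M p ` C) = totient M"
    "card ((\<lambda>N. set (shift_classes M p N)) ` C) = totient M"
    using card_C inj inj_set by (metis card_image inj_on_subset)+
  moreover have
    "shift_classes M p ` C =
      {shift_classes M p N | N. N \<in> {1..M - 1} \<and> PTE_solution p (shift_classes M p N)}"
    "(\<lambda>N. set (shift_classes M p N)) ` C =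
      {set (shift_classes M p N) | N. N \<in> {1..M - 1} \<and> PTE_solution p (shift_classes M p N)}"
    unfolding C_def by auto
  ultimately show
    "card {shift_classes M p N | N. N \<in> {1..M - 1} \<and> PTE_solution p (shift_classes M p N)}
      = totient M"
    "card {set (shift_classes M p N) | N. N \<in> {1..M - 1} \<and> PTE_solution p (shift_classes M p N)}
      = totient M"
    by simp_all
qed

end
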